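(* Consider the five Hermitian $4\times 4$ matrices $$A_1=\begin{pmatrix}0&1&0&0\\1&0&0&0\\0&0&0&0\\0&0&0&0\end{pmatrix},\quad A_2=\begin{pmatrix}0&-i&0&0\\i&0&0&0\\0&0&0&0\\0&0&0&0\end{pmatrix},\quad A_3=\begin{pmatrix}0&0&0&1\\0&0&1&0\\0&1&0&0\\1&0&0&0\end{pmatrix},$$ $$A_4=\begin{pmatrix}1&0&0&0\\0&0&0&0\\0&0&0&0\\0&0&0&0\end{pmatrix},\quad A_5=\begin{pmatrix}0&0&0&0\\0&1&0&0\\0&0&0&0\\0&0&0&0\end{pmatrix}.$$ Then: (1) $A_1,\dots,A_5$ are linearly independent over $\mathbb{R}$; (2) $A_1,\dots,A_5$ satisfy the condition of Tumanov, that is, there is $c=(c_1,\dots,c_5)\in\mathbb{R}^5$ such that $\det\big(\sum_{j=1}^5 c_jA_j\big)\neq 0$. *)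

theory Defs
  imports "HOL-Analysis.Analysis"
begin

definition A1 :: "complex^4^4" where
  "A1 = vector [vector [0, 1, 0, 0],
                vector [1, 0, 0, 0],
                vector [0, 0, 0, 0],
                vector [0, 0, 0, 0]]"

definition A2 :: "complex^4^4" where
  "A2 = vector [vector [0, -\<i>, 0, 0],
                vector [\<i>, 0, 0, 0],
                vector [0, 0, 0, 0],
                vector [0, 0, 0, 0]]"

definition A3 :: "complex^4^4" where
  "A3 = vector [vector [0, 0, 0, 1],
                vector [0, 0, 1, 0],
                vector [0, 1, 0, 0],
                vector [1, 0, 0, 0]]"

definition A4 :: "complex^4^4" where
  "A4 = vector [vector [1, 0, 0, 0],
                vector [0, 0, 0, 0],
                vector [0, 0, 0, 0],
                vector [0, 0, 0, 0]]"

definition A5 :: "complex^4^4" where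
  "A5 = vector [vector [0, 0, 0, 0],
                vector [0, 1, 0, 0],
                vector [0, 0, 0, 0],
                vector [0, 0, 0, 0]]"

definition A :: "5 \<Rightarrow> complex^4^4" where
  "A j = (vector [A1, A2, A3, A4, A5] :: (complex^4^4)^5) $ j"

definition hermitian :: "complex^'n^'n \<Rightarrow> bool" where
  "hermitian M \<longleftrightarrow> (\<forall>i j. M $ i $ j = cnj (M $ j $ i))"

text \<open>Injectivity is required because \<^const>\<open>independent\<close> is a property of sets, which
  do not record repetitions in a family.\<close>

definition independent_family :: "('k \<Rightarrow> 'v::real_vector) \<Rightarrow> bool" where
  "independent_family F \<longleftrightarrow> inj F \<and> independent (range F)"

definition tumanov :: "('k::finite \<Rightarrow> complex^'n^'n) \<Rightarrow> bool" where
  "tumanov F \<longleftrightarrow> (\<exists>c::real^'k. det (\<Sum>j\<in>UNIV. (c $ j) *\<^sub>R F j) \<noteq> 0)"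

lemma vector_4 [simp]:
  "(vector [x, y, z, w] :: 'a::zero^4) $ 1 = x"
  "(vector [x, y, z, w] :: 'a::zero^4) $ 2 = y"
  "(vector [x, y, z, w] :: 'a::zero^4) $ 3 = z"
  "(vector [x, y, z, w] :: 'a::zero^4) $ 4 = w"
  unfolding vector_def by simp_all

text \<open>In the index type \<^typ>\<open>5\<close>, the numeral 5 equals 0.\<close>

lemma A_simps: "A 1 = A1" "A 2 = A2" "A 3 = A3" "A 4 = A4" "A 5 = A5"
  unfolding A_def vector_def by simp_all

lemma UNIV_5: "UNIV = {1, 2, 3, 4, 5 :: 5}"
proof -
  have "card {1, 2, 3, 4, 5 :: 5} = CARD(5)" by simp
  then show ?thesis by (metis card_eq_UNIV_imp_eq_UNIV finite)
qed

lemma hermitian_A: "hermitian (A j)"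
proof -
  have "j \<in> {1, 2, 3, 4, 5}" using UNIV_5 by blast
  then show ?thesis
    by (auto simp: A_simps hermitian_def forall_4 A1_def A2_def A3_def A4_def A5_def)
qed

end

theory Submission
  imports Defs
begin

text \<open>The entries (1,2), (1,4), (1,1), (2,2) of a real combination of the matrices are
  \<open>c 1 - \<i> * c 2\<close>, \<open>c 3\<close>, \<open>c 4\<close>, \<open>c 5\<close>, so a
  vanishing combination has only zero coefficients (\<open>independent_family_A\<close>). For the
  determinant condition \<open>A3\<close> alone suffices: it is a permutation matrix of order two,
  hence invertible (\<open>tumanov_A\<close>).\<close>

text \<open>Bridges coefficients indexed by the family and the set-based \<open>independent\<close>:
  a repeated member would itself give a nontrivial relation, and once \<open>F\<close> is injective,
  relations on its range pull back along \<open>F\<close>.\<close>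

lemma independent_familyI:
  fixes F :: "'k::finite \<Rightarrow> 'v::real_vector"
  assumes zero: "\<And>c. (\<Sum>j\<in>UNIV. c j *\<^sub>R F j) = 0 \<Longrightarrow> (\<forall>j. c j = 0)"
  shows "independent_family F"
proof -
  have inj: "inj F"
  proof (rule injI, rule ccontr)
    fix i k assume eq: "F i = F k" and ne: "i \<noteq> k"
    \<comment> \<open>The difference of the unit vectors at \<open>i\<close> and \<open>k\<close>:
      it yields \<open>F i - F k = 0\<close>, although its value at \<open>i\<close> is 1.\<close>
    define c :: "'k \<Rightarrow> real" where "c j = of_bool (j = i) - of_bool (j = k)" for j
    have "(\<Sum>j\<in>UNIV. c j *\<^sub>R F j)
        = (\<Sum>j\<in>UNIV. if j = i then F j else 0) - (\<Sum>j\<in>UNIV. if j = k then F j else 0)"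
      unfolding sum_subtractf[symmetric] by (rule sum.cong) (auto simp: c_def)
    then have "(\<Sum>j\<in>UNIV. c j *\<^sub>R F j) = 0"
      using eq by simp
    then have "c i = 0" using zero by blast
    with ne show False by (simp add: c_def)
  qed
  have "u v = 0" if "(\<Sum>w\<in>range F. u w *\<^sub>R w) = 0" "v \<in> range F" for u v
    using zero[of "u \<circ> F"] that by (auto simp: sum.reindex[OF inj])
  then have "independent (range F)"
    by (auto simp: dependent_finite)
  with inj show ?thesis by (simp add: independent_family_def)
qed

lemma independent_family_A: "independent_family A"
proof (rule independent_familyI)
  fix c :: "5 \<Rightarrow> real"
  assume "(\<Sum>j\<in>UNIV. c j *\<^sub>R A j) = 0"
  moreover have "(\<Sum>j\<in>UNIV. c j *\<^sub>R A j)
      = c 1 *\<^sub>R A1 + c 2 *\<^sub>R A2 + c 3 *\<^sub>R A3 + c 4 *\<^sub>R A4 + c 5 *\<^sub>R A5"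
    \<comment> \<open>The simplifier turns the index 5 into 0, so the fifth equation is needed in
      the form \<open>A 0 = A5\<close>.\<close>
    unfolding UNIV_5 by (simp add: A_simps(1-4) A_simps(5)[simplified] add.assoc)
  ultimately have eq: "(c 1 *\<^sub>R A1 + c 2 *\<^sub>R A2 + c 3 *\<^sub>R A3 + c 4 *\<^sub>R A4 + c 5 *\<^sub>R A5) $ i $ k = 0"
    for i k by simp
  have "c 1 = 0" "c 2 = 0" "c 3 = 0" "c 4 = 0" "c 5 = 0"
    \<comment> \<open>Entry (1,2) settles both \<open>c 1\<close> and \<open>c 2\<close>, as its
      real part and negated imaginary part.\<close>
    using eq[of 1 2] eq[of 1 4] eq[of 1 1] eq[of 2 2]
    by (simp_all add: A1_def A2_def A3_def A4_def A5_def complex_eq_iff)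
  then show "\<forall>j. c j = 0"
    using UNIV_5 by (metis UNIV_I empty_iff insert_iff)
qed

lemma A3_squared: "A3 ** A3 = mat 1"
  by (simp add: vec_eq_iff matrix_matrix_mult_def mat_def forall_4 sum_4 A3_def)

lemma tumanov_A: "tumanov A"
proof -
  have "det A3 * det A3 = 1"
    by (simp flip: det_mul add: A3_squared)
  then have "det A3 \<noteq> 0" by auto
  \<comment> \<open>The witness is the third unit vector, which selects \<open>A3\<close>.\<close>
  have "(\<Sum>j\<in>UNIV. (axis 3 1 :: real^5) $ j *\<^sub>R A j)
      = (\<Sum>j\<in>UNIV. if j = 3 then A j else 0)"
    by (rule sum.cong) (auto simp: axis_def)
  then have "(\<Sum>j\<in>UNIV. (axis 3 1 :: real^5) $ j *\<^sub>R A j) = A3"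
    by (simp add: A_simps)
  with \<open>det A3 \<noteq> 0\<close> show ?thesis unfolding tumanov_def by metis
qed

theorem lemma2:
  shows "independent_family A \<and> tumanov A"
  using independent_family_A tumanov_A by simp

end
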